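(* Let $\mathcal{H}$ be the twisted Heisenberg-Virasoro algebra. A linear map $\phi:\mathcal{H}\to\mathcal{H}$ is commuting if and only if there are $\lambda\in\mathbb{C}$ and a linear map $\tau:\mathcal{H}\to Z(\mathcal{H})$ such that $\phi(x)=\lambda x+\tau(x)$ for all $x\in\mathcal{H}$.
   Context: The twisted Heisenberg-Virasoro algebra $\mathcal{H}$ is the complex Lie algebra with $\mathbb{C}$-basis $\{L_n,I_n,C_1,C_2,C_3\mid n\in\mathbb{Z}\}$ and Lie brackets, for all $m,n\in\mathbb{Z}$, $$[L_n,L_m]=(n-m)L_{m+n}+\tfrac{n^3-n}{12}\delta_{n,-m}C_1,\quad [L_n,I_m]=-mI_{m+n}-(n^2+n)\delta_{n,-m}C_2,\quad [I_n,I_m]=n\delta_{n,-m}C_3,$$ $$[\mathcal{H},C_1]=[\mathcal{H},C_2]=[\mathcal{H},C_3]=0.$$ $Z(\mathcal{H})$ denotes the center of $\mathcal{H}$. A linear map $\phi$ on a Lie algebra $L$ is called commuting if $[\phi(x),x]=0$ for all $x\in L$. *)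

theory Defs
  imports Complex_Main "HOL-Library.Poly_Mapping"
begin

locale lie_algebra = vector_space scale
  for scale :: "'k::field \<Rightarrow> 'a::ab_group_add \<Rightarrow> 'a" (infixr \<open>*s\<close> 75) +
  fixes bracket :: "'a \<Rightarrow> 'a \<Rightarrow> 'a"
  assumes bracket_add_left: "bracket (x + y) z = bracket x z + bracket y z"
    and bracket_add_right: "bracket x (y + z) = bracket x y + bracket x z"
    and bracket_scale_left: "bracket (c *s x) y = c *s bracket x y"
    and bracket_scale_right: "bracket x (c *s y) = c *s bracket x y"
    and bracket_self: "bracket x x = 0"
    and jacobi: "bracket x (bracket y z) + bracket y (bracket z x) + bracket z (bracket x y) = 0"
begin

definition center :: "'a set" where
  "center = {z. \<forall>x. bracket z x = 0}"

definition commuting :: "('a \<Rightarrow> 'a) \<Rightarrow> bool" where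
  "commuting \<phi> \<longleftrightarrow> (\<forall>x. bracket (\<phi> x) x = 0)"

end

text \<open>The twisted Heisenberg--Virasoro algebra is the space of finitely supported functions
  on the basis \<open>hv_basis\<close>; \<open>gen b\<close> is the basis vector belonging to \<open>b\<close>.\<close>

datatype hv_basis = L int | I int | C1 | C2 | C3

type_synonym hv = "hv_basis \<Rightarrow>\<^sub>0 complex"

definition hv_scale :: "complex \<Rightarrow> hv \<Rightarrow> hv" (infixr \<open>*\<^sub>H\<close> 75) where
  "c *\<^sub>H x = Poly_Mapping.map ((*) c) x"

abbreviation gen :: "hv_basis \<Rightarrow> hv" where
  "gen b \<equiv> Poly_Mapping.single b 1"

text \<open>The clause for \<open>[I\<^sub>n, L\<^sub>m]\<close> is \<open>- [L\<^sub>m, I\<^sub>n]\<close>.\<close>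

fun basis_bracket :: "hv_basis \<Rightarrow> hv_basis \<Rightarrow> hv" where
  "basis_bracket (L n) (L m) = of_int (n - m) *\<^sub>H gen (L (m + n))
     + (if n = - m then (of_int (n ^ 3 - n) / 12) *\<^sub>H gen C1 else 0)"
| "basis_bracket (L n) (I m) = (- of_int m) *\<^sub>H gen (I (m + n))
     - (if n = - m then of_int (n\<^sup>2 + n) *\<^sub>H gen C2 else 0)"
| "basis_bracket (I n) (L m) = of_int n *\<^sub>H gen (I (m + n))
     + (if n = - m then of_int (m\<^sup>2 + m) *\<^sub>H gen C2 else 0)"
| "basis_bracket (I n) (I m) = (if n = - m then of_int n *\<^sub>H gen C3 else 0)"
| "basis_bracket _ _ = 0"

definition hv_bracket :: "hv \<Rightarrow> hv \<Rightarrow> hv" where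
  "hv_bracket x y =
     (\<Sum>a\<in>Poly_Mapping.keys x. \<Sum>b\<in>Poly_Mapping.keys y. (Poly_Mapping.lookup x a * Poly_Mapping.lookup y b) *\<^sub>H basis_bracket a b)"

lemma lookup_hv_scale [simp]: "Poly_Mapping.lookup (c *\<^sub>H x) a = c * Poly_Mapping.lookup x a"
  unfolding hv_scale_def by (transfer fixing: c) (simp add: when_def)

lemma vector_space_hv: "vector_space hv_scale"
  by unfold_locales (auto intro!: poly_mapping_eqI simp: lookup_add algebra_simps)

interpretation hvs: vector_space hv_scale by (rule vector_space_hv)

lemma keys_hv_scale: "Poly_Mapping.keys (c *\<^sub>H x) \<subseteq> Poly_Mapping.keys x"
  by (auto simp: in_keys_iff)

lemma hv_bracket_superset:
  assumes "finite A" "finite B" "Poly_Mapping.keys x \<subseteq> A" "Poly_Mapping.keys y \<subseteq> B"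
  shows "hv_bracket x y = (\<Sum>a\<in>A. \<Sum>b\<in>B. (Poly_Mapping.lookup x a * Poly_Mapping.lookup y b) *\<^sub>H basis_bracket a b)"
proof -
  have inner: "(\<Sum>b\<in>Poly_Mapping.keys y. (Poly_Mapping.lookup x a * Poly_Mapping.lookup y b) *\<^sub>H basis_bracket a b)
      = (\<Sum>b\<in>B. (Poly_Mapping.lookup x a * Poly_Mapping.lookup y b) *\<^sub>H basis_bracket a b)" for a
    by (rule sum.mono_neutral_left) (use assms in \<open>auto simp: in_keys_iff\<close>)
  show ?thesis unfolding hv_bracket_def inner
    by (rule sum.mono_neutral_left) (use assms in \<open>auto simp: in_keys_iff\<close>)
qed

lemma hv_bracket_gen [simp]: "hv_bracket (gen a) (gen b) = basis_bracket a b"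
  by (simp add: hv_bracket_def)

lemma hv_bracket_add_left: "hv_bracket (x + y) z = hv_bracket x z + hv_bracket y z"
proof -
  let ?A = "Poly_Mapping.keys x \<union> Poly_Mapping.keys y"
  have "Poly_Mapping.keys (x + y) \<subseteq> ?A" by (rule keys_add)
  then show ?thesis
    by (simp add: hv_bracket_superset[where A = ?A and B = "Poly_Mapping.keys z"] lookup_add
        distrib_right hvs.scale_left_distrib sum.distrib)
qed

lemma hv_bracket_add_right: "hv_bracket z (x + y) = hv_bracket z x + hv_bracket z y"
proof -
  let ?A = "Poly_Mapping.keys x \<union> Poly_Mapping.keys y"
  have "Poly_Mapping.keys (x + y) \<subseteq> ?A" by (rule keys_add)
  then show ?thesis
    by (simp add: hv_bracket_superset[where B = ?A and A = "Poly_Mapping.keys z"] lookup_add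
        distrib_left hvs.scale_left_distrib sum.distrib)
qed

lemma hv_bracket_scale_left: "hv_bracket (c *\<^sub>H x) y = c *\<^sub>H hv_bracket x y"
  by (simp add: hv_bracket_superset[where A = "Poly_Mapping.keys x" and B = "Poly_Mapping.keys y"] keys_hv_scale
      hvs.scale_sum_right mult.assoc)

lemma hv_bracket_scale_right: "hv_bracket x (c *\<^sub>H y) = c *\<^sub>H hv_bracket x y"
  by (simp add: hv_bracket_superset[where A = "Poly_Mapping.keys x" and B = "Poly_Mapping.keys y"] keys_hv_scale
      hvs.scale_sum_right mult.left_commute)

lemma hv_induct [case_names zero add scale gen]:
  assumes "P 0" "\<And>x y. P x \<Longrightarrow> P y \<Longrightarrow> P (x + y)" "\<And>c x. P x \<Longrightarrow> P (c *\<^sub>H x)" "\<And>b. P (gen b)"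
  shows "P (x :: hv)"
proof -
  have e: "x = (\<Sum>a\<in>Poly_Mapping.keys x. Poly_Mapping.lookup x a *\<^sub>H gen a)"
    by (rule poly_mapping_eqI)
      (auto simp: lookup_sum lookup_single when_def if_distrib sum.delta in_keys_iff cong: if_cong)
  have "P (\<Sum>a\<in>A. Poly_Mapping.lookup x a *\<^sub>H gen a)" if "finite A" for A
    using that by (induction A rule: finite_induct) (use assms in auto)
  from this[of "Poly_Mapping.keys x"] e show ?thesis by simp
qed

lemma hv_bracket_zero [simp]: "hv_bracket 0 x = 0" "hv_bracket x 0 = 0"
  by (simp_all add: hv_bracket_def)

lemma basis_bracket_skew: "basis_bracket a b = - basis_bracket b a"
  by (cases a; cases b)
    (auto intro!: poly_mapping_eqI simp: lookup_add lookup_minus lookup_single when_def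
      algebra_simps power3_eq_cube diff_divide_distrib)

lemma hv_bracket_skew: "hv_bracket x y = - hv_bracket y x"
proof (induction x rule: hv_induct)
  case (gen a)
  show ?case
  proof (induction y rule: hv_induct)
    case (gen b)
    show ?case using basis_bracket_skew[of a b] by (simp only: hv_bracket_gen)
  qed (simp_all add: hv_bracket_add_left hv_bracket_add_right
      hv_bracket_scale_left hv_bracket_scale_right)
qed (simp_all add: hv_bracket_add_left hv_bracket_add_right
      hv_bracket_scale_left hv_bracket_scale_right)

lemma hv_bracket_self: "hv_bracket x x = 0"
proof (rule poly_mapping_eqI)
  fix k
  have "Poly_Mapping.lookup (hv_bracket x x) k = Poly_Mapping.lookup (- hv_bracket x x) k"
    using hv_bracket_skew[of x x] by simp
  then show "Poly_Mapping.lookup (hv_bracket x x) k = Poly_Mapping.lookup 0 k" by simp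
qed

lemmas hv_bracket_bilinear = hv_bracket_add_left hv_bracket_add_right
  hv_bracket_scale_left hv_bracket_scale_right

lemma hv_bracket_neg: "hv_bracket (- x) y = - hv_bracket x y" "hv_bracket x (- y) = - hv_bracket x y"
  using hv_bracket_scale_left[of "-1" x y] hv_bracket_scale_right[of x "-1" y] by simp_all

lemma hv_bracket_diff: "hv_bracket x (y - z) = hv_bracket x y - hv_bracket x z"
  using hv_bracket_add_right[of x y "- z"] by (simp add: hv_bracket_neg)

lemma hv_bracket_if [simp]:
  "hv_bracket x (if P then y else 0) = (if P then hv_bracket x y else 0)"
  by simp

abbreviation jac :: "hv_basis \<Rightarrow> hv_basis \<Rightarrow> hv_basis \<Rightarrow> hv" where
  "jac a b c \<equiv> hv_bracket (gen a) (basis_bracket b c)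
    + hv_bracket (gen b) (basis_bracket c a) + hv_bracket (gen c) (basis_bracket a b)"

lemma jac_LLL: "jac (L k) (L m) (L n) = 0"
proof (cases "k + m + n = 0")
  case True
  then have n: "n = - k - m" by simp
  show ?thesis unfolding n
    by (rule poly_mapping_eqI)
      (auto simp: hv_bracket_bilinear hv_bracket_neg hv_bracket_diff lookup_add lookup_minus lookup_single
        when_def field_simps power3_eq_cube split: if_splits)
next
  case False
  then have "k \<noteq> - (m + n)" "m \<noteq> - (n + k)" "n \<noteq> - (k + m)"
    "k \<noteq> - (n + m)" "m \<noteq> - (k + n)" "n \<noteq> - (m + k)" by auto
  then show ?thesis
    by (intro poly_mapping_eqI)
      (auto simp: hv_bracket_bilinear hv_bracket_neg hv_bracket_diff lookup_add lookup_minus lookup_single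
        when_def algebra_simps)
qed

lemma jac_LLI: "jac (L k) (L m) (I n) = 0"
proof (cases "k + m + n = 0")
  case True
  then have n: "n = - k - m" by simp
  show ?thesis unfolding n
    by (rule poly_mapping_eqI)
      (auto simp: hv_bracket_bilinear hv_bracket_neg hv_bracket_diff lookup_add lookup_minus lookup_single
        when_def algebra_simps power2_eq_square split: if_splits)
next
  case False
  then have "k \<noteq> - (m + n)" "m \<noteq> - (n + k)" "n \<noteq> - (k + m)"
    "k \<noteq> - (n + m)" "m \<noteq> - (k + n)" "n \<noteq> - (m + k)" "k + m \<noteq> - n" "m + k \<noteq> - n" by auto
  then show ?thesis
    by (intro poly_mapping_eqI)
      (auto simp: hv_bracket_bilinear hv_bracket_neg hv_bracket_diff lookup_add lookup_minus lookup_single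
        when_def algebra_simps)
qed

lemma jac_LII: "jac (L k) (I m) (I n) = 0"
  by (intro poly_mapping_eqI)
    (auto simp: hv_bracket_bilinear hv_bracket_neg hv_bracket_diff lookup_add lookup_minus lookup_single
      when_def algebra_simps)

lemma hv_jacobi_gen: "hv_bracket (gen a) (hv_bracket (gen b) (gen c))
    + hv_bracket (gen b) (hv_bracket (gen c) (gen a))
    + hv_bracket (gen c) (hv_bracket (gen a) (gen b)) = 0"
proof -
  have "jac a b c = 0"
  proof (cases "\<exists>d\<in>{a, b, c}. d \<in> {C1, C2, C3}")
    case True
    then show ?thesis
      by (cases a; cases b; cases c) (auto simp: hv_bracket_bilinear hv_bracket_neg hv_bracket_diff)
  next
    case False
    then consider k m n where "a = L k" "b = L m" "c = L n"
      | k m n where "a = L k" "b = L m" "c = I n"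
      | k m n where "a = L k" "b = I m" "c = L n"
      | k m n where "a = I k" "b = L m" "c = L n"
      | k m n where "a = L k" "b = I m" "c = I n"
      | k m n where "a = I k" "b = L m" "c = I n"
      | k m n where "a = I k" "b = I m" "c = L n"
      | k m n where "a = I k" "b = I m" "c = I n"
      by (cases a; cases b; cases c) auto
    then show ?thesis
    proof cases
      case 1 then show ?thesis by (simp only: jac_LLL)
    next
      case 2 then show ?thesis by (simp only: jac_LLI)
    next
      case 3 then show ?thesis using jac_LLI[of n k m] by (simp only: ac_simps)
    next
      case 4 then show ?thesis using jac_LLI[of m n k] by (simp only: ac_simps)
    next
      case 5 then show ?thesis by (simp only: jac_LII)
    next
      case 6 then show ?thesis using jac_LII[of m n k] by (simp only: ac_simps)
    next
      case 7 then show ?thesis using jac_LII[of n k m] by (simp only: ac_simps)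
    next
      case 8 then show ?thesis by (simp add: hv_bracket_bilinear hv_bracket_neg)
    qed
  qed
  then show ?thesis by simp
qed

lemma hv_jacobi: "hv_bracket x (hv_bracket y z) + hv_bracket y (hv_bracket z x)
    + hv_bracket z (hv_bracket x y) = 0"
proof (induction x rule: hv_induct)
  case (gen a)
  show ?case
  proof (induction y rule: hv_induct)
    case (gen b)
    show ?case
    proof (induction z rule: hv_induct)
      case (gen c)
      show ?case by (rule hv_jacobi_gen)
    next
      case (add x y) from arg_cong2[OF this, of "(+)"] show ?case
        by (simp add: hv_bracket_bilinear algebra_simps)
    next
      case (scale c x) from arg_cong[OF this, of "hv_scale c"] show ?case
        by (simp add: hv_bracket_bilinear hvs.scale_right_distrib)
    qed simp
  next
    case (add x y) from arg_cong2[OF this, of "(+)"] show ?case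
      by (simp add: hv_bracket_bilinear algebra_simps)
  next
    case (scale c x) from arg_cong[OF this, of "hv_scale c"] show ?case
      by (simp add: hv_bracket_bilinear hvs.scale_right_distrib)
  qed simp
next
  case (add x y) from arg_cong2[OF this, of "(+)"] show ?case
    by (simp add: hv_bracket_bilinear algebra_simps)
next
  case (scale c x) from arg_cong[OF this, of "hv_scale c"] show ?case
    by (simp add: hv_bracket_bilinear hvs.scale_right_distrib)
qed simp

interpretation hv: lie_algebra hv_scale hv_bracket
  by unfold_locales (rule hv_bracket_bilinear hv_bracket_self hv_jacobi)+

end

theory Submission
  imports Defs
begin

text \<open>
  Everything rests on the grading element \<open>L 0\<close>. Its adjoint action is diagonal: it multiplies
  \<open>L m\<close> and \<open>I m\<close> by \<open>- m\<close> and kills \<open>C1\<close>, \<open>C2\<close>, \<open>C3\<close>. Hence its centralizer is spanned by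
  \<open>L 0\<close>, \<open>I 0\<close> and the \<open>C\<close>'s, and all of these except \<open>L 0\<close> itself are central
  (\<open>center_if_commutes_L0\<close>). In other words, modulo the center the centralizer of \<open>L 0\<close> is the
  line through \<open>L 0\<close>.

  Let \<open>\<phi>\<close> be commuting. Polarization gives \<open>[\<phi> x, y] = [x, \<phi> y]\<close>. Since \<open>\<phi> (L 0)\<close> commutes
  with \<open>L 0\<close>, it equals \<open>c L 0\<close> modulo the center for some \<open>c\<close>, and so
  \<open>[\<phi> y, L 0] = [y, \<phi> (L 0)] = c [y, L 0]\<close> for every \<open>y\<close>. Thus \<open>\<tau> y = \<phi> y - c y\<close> always commutes
  with \<open>L 0\<close>, which means \<open>\<tau> y = a y L 0\<close> modulo the center, for a linear functional \<open>a\<close>.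
  As \<open>\<tau>\<close> is again commuting, \<open>a y [L 0, y] = 0\<close>, so \<open>a\<close> vanishes off the centralizer of
  \<open>L 0\<close>. That centralizer is a proper subspace, and a linear functional that vanishes off a
  proper subspace is zero. Therefore \<open>\<tau>\<close> takes central values.
\<close>

lemma (in lie_algebra) bracket_minus_left: "bracket (- x) y = - bracket x y"
  using bracket_scale_left[of "- 1" x y] by simp

lemma (in lie_algebra) bracket_diff_left: "bracket (x - y) z = bracket x z - bracket y z"
  using bracket_add_left[of x "- y" z] by (simp add: bracket_minus_left)

lemma (in lie_algebra) bracket_skew: "bracket x y = - bracket y x"
proof -
  have "bracket (x + y) x + bracket (x + y) y = 0"
    by (simp only: bracket_add_right[symmetric] bracket_self)
  then have "bracket x y + bracket y x = 0"
    by (simp add: bracket_add_left bracket_self add.commute)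
  then show ?thesis
    by (simp only: eq_neg_iff_add_eq_0)
qed

text \<open>Polarization of \<open>[\<phi> x, x] = 0\<close> at \<open>x + y\<close>.\<close>

lemma (in lie_algebra) commuting_polarized:
  assumes "commuting \<phi>" and "\<And>x y. \<phi> (x + y) = \<phi> x + \<phi> y"
  shows "bracket (\<phi> x) y = bracket x (\<phi> y)"
proof -
  have self: "bracket (\<phi> z) z = 0" for z
    using assms(1) by (simp add: commuting_def)
  have "bracket (\<phi> x) y + bracket (\<phi> y) x = 0"
    using self[of "x + y"] self[of x] self[of y]
    by (simp add: assms(2) bracket_add_left bracket_add_right add.commute)
  then have "bracket (\<phi> x) y = - bracket (\<phi> y) x"
    by (simp only: eq_neg_iff_add_eq_0)
  also have "\<dots> = bracket x (\<phi> y)"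
    by (rule bracket_skew[symmetric])
  finally show ?thesis .
qed

lemma (in lie_algebra) commuting_scale_plus_central:
  assumes "range \<tau> \<subseteq> center" and "\<And>x. \<phi> x = c *s x + \<tau> x"
  shows "commuting \<phi>"
  unfolding commuting_def
proof
  fix x
  have "bracket (\<tau> x) x = 0"
    using assms(1) by (auto simp: center_def)
  then show "bracket (\<phi> x) x = 0"
    by (simp add: assms(2) bracket_add_left bracket_scale_left bracket_self)
qed

fun weight :: "hv_basis \<Rightarrow> int" where
  "weight (L m) = m"
| "weight (I m) = m"
| "weight C1 = 0"
| "weight C2 = 0"
| "weight C3 = 0"

lemma lookup_bracket_L0:
  "Poly_Mapping.lookup (hv_bracket (gen (L 0)) x) b
     = - of_int (weight b) * Poly_Mapping.lookup x b"
proof (induction x rule: hv_induct)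
  case (gen a)
  show ?case
    by (cases a; cases b)
      (auto simp: lookup_add lookup_minus lookup_single when_def)
qed (simp_all add: hv_bracket_bilinear lookup_add algebra_simps)

text \<open>An element commuting with \<open>L 0\<close> is supported on \<open>L 0\<close>, \<open>I 0\<close> and the \<open>C\<close>'s.
  The vector \<open>I 0\<close> is central: \<open>[L n, I m]\<close> contains \<open>I (m + n)\<close> with coefficient \<open>- m\<close>, and
  for \<open>m = 0\<close> the terms in \<open>C2\<close> and \<open>C3\<close> occur only at \<open>n = 0\<close>, where their coefficients
  \<open>n\<^sup>2 + n\<close> and \<open>n\<close> vanish.\<close>

lemma center_if_commutes_L0:
  assumes "hv_bracket (gen (L 0)) z = 0" and "Poly_Mapping.lookup z (L 0) = 0"
  shows "z \<in> hv.center"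
proof -
  have "weight a = 0" if "a \<in> Poly_Mapping.keys z" for a
    using lookup_bracket_L0[of z a] that by (simp add: assms(1) in_keys_iff)
  moreover have "L 0 \<notin> Poly_Mapping.keys z"
    using assms(2) by (simp add: in_keys_iff)
  ultimately have supp: "a \<in> {I 0, C1, C2, C3}" if "a \<in> Poly_Mapping.keys z" for a
    using that by (cases a) force+
  have "basis_bracket a b = 0" if "a \<in> {I 0, C1, C2, C3}" for a b
    using that by (cases b) auto
  with supp have "hv_bracket z x = 0" for x
    unfolding hv_bracket_def by (intro sum.neutral ballI) simp
  then show ?thesis
    by (simp add: hv.center_def)
qed

lemma bracket_if_commutes_L0:
  assumes "hv_bracket (gen (L 0)) z = 0"
  shows "hv_bracket z x = Poly_Mapping.lookup z (L 0) *\<^sub>H hv_bracket (gen (L 0)) x"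
proof -
  have "z - Poly_Mapping.lookup z (L 0) *\<^sub>H gen (L 0) \<in> hv.center"
    by (rule center_if_commutes_L0)
      (simp_all add: assms hv_bracket_diff hv_bracket_scale_right hv_bracket_self
        lookup_minus lookup_single)
  then show ?thesis
    by (simp add: hv.center_def hv.bracket_diff_left hv_bracket_scale_left)
qed

text \<open>Only the coefficient of \<open>L 0\<close> in \<open>\<tau> y\<close> has to be excluded. For \<open>y\<close> outside the centralizer
  of \<open>L 0\<close> it vanishes because \<open>\<tau>\<close> is commuting. An element \<open>y\<close> of the centralizer leaves it
  when \<open>L 1\<close> is added, and the coefficient vanishes at both \<open>y + L 1\<close> and \<open>L 1\<close>.\<close>

lemma commuting_into_centralizer_L0_central:
  assumes comm: "hv.commuting \<tau>"
    and add: "\<And>x y. \<tau> (x + y) = \<tau> x + \<tau> y"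
    and L0: "\<And>x. hv_bracket (gen (L 0)) (\<tau> x) = 0"
  shows "\<tau> y \<in> hv.center"
proof (rule center_if_commutes_L0[OF L0])
  let ?a = "\<lambda>x. Poly_Mapping.lookup (\<tau> x) (L 0)"
  have off: "?a x = 0" if "hv_bracket (gen (L 0)) x \<noteq> 0" for x
  proof -
    have "?a x *\<^sub>H hv_bracket (gen (L 0)) x = 0"
      using comm bracket_if_commutes_L0[OF L0, of x x] by (simp add: hv.commuting_def)
    with that show ?thesis by simp
  qed
  have L1: "hv_bracket (gen (L 0)) (gen (L 1)) \<noteq> 0"
  proof
    assume "hv_bracket (gen (L 0)) (gen (L 1)) = 0"
    then show False
      using lookup_bracket_L0[of "gen (L 1)" "L 1"] by (simp del: hv_bracket_gen)
  qed
  show "?a y = 0"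
  proof (cases "hv_bracket (gen (L 0)) y = 0")
    case True
    then have "?a (y + gen (L 1)) = 0"
      using L1 by (intro off) (simp only: hv_bracket_add_right add_0_left not_False_eq_True)
    with off[OF L1] show ?thesis
      by (simp add: add lookup_add)
  qed (rule off)
qed

theorem theorem4p1:
  fixes \<phi> :: "hv \<Rightarrow> hv"
  assumes "Vector_Spaces.linear hv_scale hv_scale \<phi>"
  shows "hv.commuting \<phi> \<longleftrightarrow>
    (\<exists>c::complex. \<exists>\<tau>::hv \<Rightarrow> hv.
       Vector_Spaces.linear hv_scale hv_scale \<tau> \<and> range \<tau> \<subseteq> hv.center \<and>
       (\<forall>x. \<phi> x = c *\<^sub>H x + \<tau> x))"
proof
  assume comm: "hv.commuting \<phi>"
  interpret \<phi>: Vector_Spaces.linear hv_scale hv_scale \<phi> by fact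
  note pol = hv.commuting_polarized[OF comm \<phi>.add]
  define c where "c = Poly_Mapping.lookup (\<phi> (gen (L 0))) (L 0)"
  define \<tau> where "\<tau> x = \<phi> x - c *\<^sub>H x" for x
  have lin: "Vector_Spaces.linear hv_scale hv_scale \<tau>"
    by unfold_locales
      (simp_all add: \<tau>_def \<phi>.add \<phi>.scale hvs.scale_right_distrib
        hvs.scale_right_diff_distrib mult.commute)
  have add: "\<tau> (x + y) = \<tau> x + \<tau> y" for x y
    by (simp add: \<tau>_def \<phi>.add hvs.scale_right_distrib)
  have comm_\<tau>: "hv.commuting \<tau>"
    using comm
    by (simp add: hv.commuting_def \<tau>_def hv.bracket_diff_left hv_bracket_scale_left hv_bracket_self)
  have "hv_bracket (gen (L 0)) (\<phi> (gen (L 0))) = 0"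
    using comm pol[of "gen (L 0)" "gen (L 0)"] by (simp only: hv.commuting_def)
  then have "hv_bracket (\<phi> (gen (L 0))) x = c *\<^sub>H hv_bracket (gen (L 0)) x" for x
    unfolding c_def by (rule bracket_if_commutes_L0)
  then have L0: "hv_bracket (gen (L 0)) (\<tau> x) = 0" for x
    by (simp add: \<tau>_def hv_bracket_diff hv_bracket_scale_right pol[symmetric])
  have "range \<tau> \<subseteq> hv.center"
    using commuting_into_centralizer_L0_central[OF comm_\<tau> add L0] by auto
  moreover have "\<phi> x = c *\<^sub>H x + \<tau> x" for x
    by (simp add: \<tau>_def)
  ultimately show "\<exists>c \<tau>. Vector_Spaces.linear hv_scale hv_scale \<tau> \<and> range \<tau> \<subseteq> hv.center \<and>
      (\<forall>x. \<phi> x = c *\<^sub>H x + \<tau> x)"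
    using lin by blast
next
  assume "\<exists>c \<tau>. Vector_Spaces.linear hv_scale hv_scale \<tau> \<and> range \<tau> \<subseteq> hv.center \<and>
      (\<forall>x. \<phi> x = c *\<^sub>H x + \<tau> x)"
  then obtain c \<tau> where "range \<tau> \<subseteq> hv.center" "\<And>x. \<phi> x = c *\<^sub>H x + \<tau> x"
    by blast
  then show "hv.commuting \<phi>"
    by (rule hv.commuting_scale_plus_central)
qed

end
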